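(* Let $\mathbb{K}$ be a field with $\mathrm{char}\,\mathbb{K}\neq 3$ containing an element $\theta$ with $\theta^3=1\neq\theta$. Let $A=Q^{p,q,r}$ be a degenerate Sklyanin algebra over $\mathbb{K}$. Then: (1) $A=\mathbb{K}\langle x,y,z\rangle$ if and only if $p=q=r=0$; (2) $A$ is isomorphic to the monomial algebra $Q^{1,0,0}$ given by the relations $xy=zx=yz=0$ if and only if either $r=0$, $pq=0$ and $(p,q)\neq(0,0)$, or $p^3=q^3=r^3\neq0$ and $p\neq q$; (3) $A$ is isomorphic to the monomial algebra $Q^{0,0,1}$ given by the relations $xx=yy=zz=0$ if and only if either $p=q=0$ and $r\neq0$, or $p=q\neq0$ and $p^3=r^3$. Furthermore, the algebras $\mathbb{K}\langle x,y,z\rangle$, $Q^{1,0,0}$ and $Q^{0,0,1}$ are pairwise non-isomorphic, and a degenerate Sklyanin algebra cannot be isomorphic to a non-degenerate one.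
   Context: For $(p,q,r)\in\mathbb{K}^3$, the Sklyanin algebra $Q^{p,q,r}$ is the associative unital $\mathbb{K}$-algebra with generators $x,y,z$ and relations $pyz+qzy+rxx=0$, $pzx+qxz+ryy=0$, $pxy+qyx+rzz=0$, graded by degree. It is called degenerate if $(pq,pr,qr)=(0,0,0)$ (at least two of $p,q,r$ are zero) or $p^3=q^3=r^3$, and non-degenerate otherwise. $\mathbb{K}\langle x,y,z\rangle$ is the free associative unital algebra. Isomorphism means isomorphism of graded $\mathbb{K}$-algebras (given by an invertible linear change of the generators). *)

theory Defs
  imports "HOL-Algebra.Module" "HOL-Algebra.QuotRing" "HOL-Library.Poly_Mapping"
begin

section \<open>The free associative algebra on three generators\<close>

datatype gen = Gen_x | Gen_y | Gen_z

text \<open>Words in the generators form a monoid under concatenation, written additively so that the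
  multiplication of \<^typ>\<open>'a \<Rightarrow>\<^sub>0 'k\<close> is the (noncommutative) convolution product. Thus
  \<open>word \<Rightarrow>\<^sub>0 'k\<close> is the monoid algebra of the free monoid.\<close>

datatype word = Word (letters: "gen list")

instantiation word :: monoid_add
begin

definition zero_word :: word where
  "zero_word = Word []"

definition plus_word :: "word \<Rightarrow> word \<Rightarrow> word" where
  "plus_word u v = Word (letters u @ letters v)"

instance
  by standard (simp_all add: zero_word_def plus_word_def)

end

type_synonym 'k ncpoly = "word \<Rightarrow>\<^sub>0 'k"

definition const :: "'k::field \<Rightarrow> 'k ncpoly" where
  "const c = Poly_Mapping.single 0 c"

definition var :: "gen \<Rightarrow> 'k::field ncpoly" where
  "var g = Poly_Mapping.single (Word [g]) 1"


section \<open>Graded algebras\<close>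

text \<open>\<^term>\<open>grade A n\<close> is the homogeneous component of degree \<open>n\<close>. The scalars are all elements
  of the type \<^typ>\<open>'k\<close>. The \<open>algebra\<close> locale of \<^theory>\<open>HOL-Algebra.Module\<close> is not used because it
  requires commutativity.\<close>

record ('k, 'a) graded_algebra = "('k, 'a) module" +
  grade :: "nat \<Rightarrow> 'a set"

definition free_algebra :: "('k::field, 'k ncpoly) graded_algebra" where
  "free_algebra =
    \<lparr>carrier = UNIV, mult = (*), one = 1, zero = 0, add = (+),
     smult = (\<lambda>c f. const c * f),
     grade = (\<lambda>n. {f. \<forall>w\<in>Poly_Mapping.keys f. length (letters w) = n})\<rparr>"

definition quotient_algebra ::
    "('k, 'a) graded_algebra \<Rightarrow> 'a set \<Rightarrow> ('k, 'a set) graded_algebra" where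
  "quotient_algebra A I =
    \<lparr>carrier = carrier (A Quot I), mult = mult (A Quot I), one = one (A Quot I),
     zero = zero (A Quot I), add = add (A Quot I),
     smult = (\<lambda>c C. \<Union>a\<in>C. I +>\<^bsub>A\<^esub> (c \<odot>\<^bsub>A\<^esub> a)),
     grade = (\<lambda>n. (\<lambda>a. I +>\<^bsub>A\<^esub> a) ` grade A n)\<rparr>"

definition graded_iso ::
    "('k, 'a) graded_algebra \<Rightarrow> ('k, 'b) graded_algebra \<Rightarrow> ('a \<Rightarrow> 'b) set" where
  "graded_iso A B =
    {h \<in> ring_iso A B.
       (\<forall>c. \<forall>a\<in>carrier A. h (c \<odot>\<^bsub>A\<^esub> a) = c \<odot>\<^bsub>B\<^esub> h a) \<and>
       (\<forall>n. h ` grade A n = grade B n)}"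

definition graded_isomorphic ::
    "('k, 'a) graded_algebra \<Rightarrow> ('k, 'b) graded_algebra \<Rightarrow> bool"  (infix \<open>\<cong>\<^sub>g\<^sub>r\<close> 50) where
  "A \<cong>\<^sub>g\<^sub>r B \<longleftrightarrow> graded_iso A B \<noteq> {}"


section \<open>Presented algebras and Sklyanin algebras\<close>

text \<open>\<^const>\<open>genideal\<close> is the generated two-sided ideal.\<close>

definition presented_algebra :: "'k::field ncpoly set \<Rightarrow> ('k, 'k ncpoly set) graded_algebra" where
  "presented_algebra R = quotient_algebra free_algebra (Idl\<^bsub>free_algebra\<^esub> R)"

definition presentation_map :: "'k::field ncpoly set \<Rightarrow> 'k ncpoly \<Rightarrow> 'k ncpoly set" where
  "presentation_map R f = (Idl\<^bsub>free_algebra\<^esub> R) +>\<^bsub>free_algebra\<^esub> f"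

definition sklyanin_relations :: "'k::field \<Rightarrow> 'k \<Rightarrow> 'k \<Rightarrow> 'k ncpoly set" where
  "sklyanin_relations p q r =
    (let x = var Gen_x; y = var Gen_y; z = var Gen_z in
      {const p * y * z + const q * z * y + const r * x * x,
       const p * z * x + const q * x * z + const r * y * y,
       const p * x * y + const q * y * x + const r * z * z})"

definition sklyanin :: "'k::field \<Rightarrow> 'k \<Rightarrow> 'k \<Rightarrow> ('k, 'k ncpoly set) graded_algebra" where
  "sklyanin p q r = presented_algebra (sklyanin_relations p q r)"

definition degenerate :: "'k::field \<Rightarrow> 'k \<Rightarrow> 'k \<Rightarrow> bool" where
  "degenerate p q r \<longleftrightarrow> (p * q, p * r, q * r) = (0, 0, 0) \<or> (p ^ 3 = q ^ 3 \<and> q ^ 3 = r ^ 3)"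

text \<open>The equality \<open>Q\<^bsup>p,q,r\<^esup> = K\<langle>x,y,z\<rangle>\<close>, as opposed to an abstract isomorphism: the canonical map
  from the free algebra, which sends generators to generators, is an isomorphism.\<close>

definition sklyanin_is_free :: "'k::field \<Rightarrow> 'k \<Rightarrow> 'k \<Rightarrow> bool" where
  "sklyanin_is_free p q r \<longleftrightarrow>
    presentation_map (sklyanin_relations p q r) \<in> graded_iso free_algebra (sklyanin p q r)"

end

theory Submission
  imports Defs
begin

text \<open>In degree two the ideal of \<open>Q\<^bsup>p,q,r\<^esup>\<close> is spanned by the three relations, so products of linear
  forms that vanish in \<open>Q\<^bsup>p,q,r\<^esup>\<close> are the rank one matrices in a space of 3 by 3 matrices. The
  vanishing of the 2 by 2 minors shows that a nonzero such matrix exists only in the degenerate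
  case. When \<open>p\<^sup>3 = q\<^sup>3 = r\<^sup>3 \<noteq> 0\<close> the space is even spanned by rank one
  matrices, and the linear forms in them are the new generators that make the relations monomial.
  The existence of a linear zero divisor and of a linear form with square zero then tell apart the
  free algebra, \<open>Q\<^bsup>1,0,0\<^esup>\<close> and \<open>Q\<^bsup>0,0,1\<^esup>\<close>. Only the free algebra and the non-degenerate algebras need
  another argument: an isomorphism would carry the nontrivial quadratic relations to relations
  between linearly independent linear forms of the free algebra.\<close>

section \<open>Arithmetic in the free algebra\<close>

alias lookup = Poly_Mapping.lookup

lemma UNIV_gen: "(UNIV :: gen set) = {Gen_x, Gen_y, Gen_z}"
  using gen.exhaust by auto

instance gen :: finite
  by standard (simp add: UNIV_gen)

lemma sum_gen: "(\<Sum>g\<in>UNIV. F g) = F Gen_x + F Gen_y + F Gen_z"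
  for F :: "gen \<Rightarrow> 'a::comm_monoid_add"
  by (simp add: UNIV_gen add.assoc)

lemma all_gen: "(\<forall>g. P g) \<longleftrightarrow> P Gen_x \<and> P Gen_y \<and> P Gen_z"
  by (metis gen.exhaust)

text \<open>Every polynomial is a finite sum of monomials, zero being a monomial with coefficient 0,
  so additive claims reduce to single words.\<close>

lemma ncpoly_induct [case_names single add]:
  fixes f :: "'k::field ncpoly"
  assumes "\<And>w c. P (Poly_Mapping.single w c)" and "\<And>f g. P f \<Longrightarrow> P g \<Longrightarrow> P (f + g)"
  shows "P f"
proof (induction f rule: Poly_Mapping.update_induct)
  case const
  show ?case using assms(1)[of 0 0] by simp
next
  case (update f w c)
  have "Poly_Mapping.update w c f = Poly_Mapping.single w c + f"
    using update(1)
    by (intro poly_mapping_eqI)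
      (auto simp: lookup_update lookup_add lookup_single when_def in_keys_iff)
  then show ?case using assms update by simp
qed

text \<open>In a free monoid the factorizations of a word are its cuts into a prefix and a suffix,
  so the convolution sum runs over cut positions. Both sides are bilinear, which leaves the case of
  two monomials.\<close>

lemma lookup_mult_word:
  fixes f g :: "'k::field ncpoly"
  shows "lookup (f * g) (Word w) =
    (\<Sum>i\<le>length w. lookup f (Word (take i w)) * lookup g (Word (drop i w)))"
proof (induction f rule: ncpoly_induct)
  case (single u c)
  show ?case
  proof (induction g rule: ncpoly_induct)
    case (single v d)
    obtain us vs where [simp]: "u = Word us" "v = Word vs" by (cases u, cases v) auto
    \<comment> \<open>For monomials only the cut after \<open>length us\<close> letters can
      contribute.\<close>
    have "lookup (Poly_Mapping.single u c) (Word (take i w)) *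
        lookup (Poly_Mapping.single v d) (Word (drop i w)) =
        (if i = length us then (c * d when us @ vs = w) else 0)" if "i \<le> length w" for i
    proof (cases "us = take i w \<and> vs = drop i w")
      case True
      then have "us @ vs = w" "length us = i" using that by auto
      with True show ?thesis by (simp add: lookup_single)
    next
      case False
      then have "i \<noteq> length us \<or> us @ vs \<noteq> w" by auto
      with False show ?thesis by (auto simp: lookup_single when_def)
    qed
    then have "(\<Sum>i\<le>length w. lookup (Poly_Mapping.single u c) (Word (take i w)) *
        lookup (Poly_Mapping.single v d) (Word (drop i w))) =
        (\<Sum>i\<le>length w. if i = length us then (c * d when us @ vs = w) else 0)"
      by (intro sum.cong) auto
    also have "\<dots> = (c * d when us @ vs = w)"
      by (auto simp: when_def)
    finally show ?case
      by (simp add: mult_single lookup_single plus_word_def)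
  qed (simp add: algebra_simps lookup_add sum.distrib)
qed (simp add: algebra_simps lookup_add sum.distrib)

lemma lookup_mult_word0: "lookup (f * g) (Word []) = lookup f (Word []) * lookup g (Word [])"
  for f g :: "'k::field ncpoly"
  by (simp add: lookup_mult_word)

lemma lookup_mult_word1:
  "lookup (f * g) (Word [a]) =
    lookup f (Word []) * lookup g (Word [a]) + lookup f (Word [a]) * lookup g (Word [])"
  for f g :: "'k::field ncpoly"
  by (simp add: lookup_mult_word)

lemma lookup_mult_word2:
  "lookup (f * g) (Word [a, b]) = lookup f (Word []) * lookup g (Word [a, b]) +
    lookup f (Word [a]) * lookup g (Word [b]) + lookup f (Word [a, b]) * lookup g (Word [])"
  for f g :: "'k::field ncpoly"
  by (simp add: lookup_mult_word)

lemma const_0 [simp]: "const 0 = 0" and const_1 [simp]: "const 1 = 1"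
  by (simp_all add: const_def)

lemma const_add: "const (a + b) = const a + const b"
  by (simp add: const_def single_add)

lemma const_mult: "const (a * b) = const a * const b"
  by (simp add: const_def mult_single)

lemma const_mult_single: "const a * Poly_Mapping.single w c = Poly_Mapping.single w (a * c)"
  by (simp add: const_def mult_single)

lemma const_commute: "f * const c = const c * f"
  by (induction f rule: ncpoly_induct) (simp_all add: const_def mult_single algebra_simps)

section \<open>Substitutions: the algebra endomorphisms determined by the images of the
  generators\<close>

definition subst :: "(gen \<Rightarrow> 'k::field ncpoly) \<Rightarrow> 'k ncpoly \<Rightarrow> 'k ncpoly" where
  "subst \<phi> f =
    (\<Sum>w\<in>Poly_Mapping.keys f. const (lookup f w) * prod_list (map \<phi> (letters w)))"

text \<open>Words with coefficient zero may be added to the range, so that several polynomials are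
  summed over one common set of words; additivity follows.\<close>

lemma subst_superset:
  assumes "finite S" and "Poly_Mapping.keys f \<subseteq> S"
  shows "subst \<phi> f = (\<Sum>w\<in>S. const (lookup f w) * prod_list (map \<phi> (letters w)))"
  unfolding subst_def using assms
  by (intro sum.mono_neutral_left) (auto simp: in_keys_iff)

lemma subst_add: "subst \<phi> (f + g) = subst \<phi> f + subst \<phi> g"
proof -
  define S where "S = Poly_Mapping.keys f \<union> Poly_Mapping.keys g"
  have "finite S" "Poly_Mapping.keys f \<subseteq> S" "Poly_Mapping.keys g \<subseteq> S"
    "Poly_Mapping.keys (f + g) \<subseteq> S"
    using keys_add[of f g] by (auto simp: S_def)
  then show ?thesis
    by (simp add: subst_superset[of S] lookup_add const_add algebra_simps sum.distrib)
qed

lemma subst_single: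
  "subst \<phi> (Poly_Mapping.single w c) = const c * prod_list (map \<phi> (letters w))"
  by (simp add: subst_def)

lemma subst_mult: "subst \<phi> (f * g) = subst \<phi> f * subst \<phi> g"
proof (induction f rule: ncpoly_induct)
  case (single u c)
  show ?case
  proof (induction g rule: ncpoly_induct)
    case (single v d)
    have "const d * (prod_list (map \<phi> (letters u)) * F) =
        prod_list (map \<phi> (letters u)) * (const d * F)" for F
      by (metis const_commute mult.assoc)
    then show ?case
      by (simp add: mult_single subst_single plus_word_def const_mult mult.assoc)
  qed (simp add: algebra_simps subst_add)
qed (simp add: algebra_simps subst_add)

lemma subst_var [simp]: "subst \<phi> (var g) = \<phi> g"
  by (simp add: var_def subst_single)

lemma subst_const [simp]: "subst \<phi> (const c) = const c"
  by (simp add: const_def subst_single) (simp add: zero_word_def)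

lemma subst_0 [simp]: "subst \<phi> 0 = 0" and subst_1 [simp]: "subst \<phi> 1 = 1"
  using subst_const[of \<phi> 0] subst_const[of \<phi> 1] by simp_all

lemma subst_prod_list: "subst \<phi> (prod_list fs) = prod_list (map (subst \<phi>) fs)"
  by (induction fs) (simp_all add: subst_mult)

lemma subst_subst: "subst \<phi> (subst \<psi> f) = subst (\<lambda>g. subst \<phi> (\<psi> g)) f"
  by (induction f rule: ncpoly_induct)
    (simp_all add: subst_single subst_mult subst_add subst_prod_list comp_def)

lemma prod_list_var: "prod_list (map var gs) = Poly_Mapping.single (Word gs) 1"
  by (induction gs) (simp_all add: var_def mult_single plus_word_def flip: zero_word_def)

lemma subst_id: "subst var f = f"
  by (induction f rule: ncpoly_induct)
    (simp_all add: subst_single prod_list_var const_mult_single subst_add)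


section \<open>Presented algebras\<close>

lemma free_algebra_simps [simp]:
  "carrier free_algebra = UNIV" "mult free_algebra = (*)" "one free_algebra = 1"
  "zero free_algebra = 0" "add free_algebra = (+)" "smult free_algebra c f = const c * f"
  by (simp_all add: free_algebra_def)

lemma grade_free_algebra:
  "f \<in> grade free_algebra n \<longleftrightarrow> (\<forall>w. lookup f w \<noteq> 0 \<longrightarrow> length (letters w) = n)"
  by (auto simp: free_algebra_def in_keys_iff)

lemma ring_free_algebra: "ring (free_algebra :: ('k::field, 'k ncpoly) graded_algebra)"
proof (rule ringI)
  show "abelian_group (free_algebra :: ('k, 'k ncpoly) graded_algebra)"
  proof (rule abelian_groupI)
    fix f :: "'k ncpoly"
    have "- f + f = 0" by simp
    then show "\<exists>g\<in>carrier free_algebra. g \<oplus>\<^bsub>free_algebra\<^esub> f = \<zero>\<^bsub>free_algebra\<^esub>"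
      by (metis UNIV_I free_algebra_simps(1,4,5))
  qed (simp_all add: add.assoc add.commute)
  show "Group.monoid (free_algebra :: ('k, 'k ncpoly) graded_algebra)"
    by unfold_locales (auto simp: mult.assoc)
qed (auto simp: algebra_simps)

section \<open>Two-sided ideals of the free algebra\<close>

lemma ideal_free_algebraI:
  fixes I :: "'k::field ncpoly set"
  assumes "0 \<in> I" and "\<And>f g. f \<in> I \<Longrightarrow> g \<in> I \<Longrightarrow> f + g \<in> I"
    and "\<And>f g. f \<in> I \<Longrightarrow> g * f \<in> I" and "\<And>f g. f \<in> I \<Longrightarrow> f * g \<in> I"
  shows "ideal I free_algebra"
proof -
  interpret ring "free_algebra :: ('k, 'k ncpoly) graded_algebra"
    by (rule ring_free_algebra)
  show ?thesis
  proof (rule idealI)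
    have "\<ominus>\<^bsub>free_algebra\<^esub> f = - f" for f :: "'k ncpoly"
      by (rule minus_equality) auto
    moreover have "- f \<in> I" if "f \<in> I" for f
      using assms(3)[OF that, of "- 1"] by simp
    ultimately show "subgroup I (add_monoid free_algebra)"
      using assms(1,2) by (intro add.subgroupI) (auto simp flip: a_inv_def)
  qed (use assms in \<open>auto intro: ring_axioms\<close>)
qed

abbreviation nc_ideal :: "'k::field ncpoly set \<Rightarrow> 'k ncpoly set" where
  "nc_ideal R \<equiv> Idl\<^bsub>free_algebra\<^esub> R"

lemma ideal_nc_ideal: "ideal (nc_ideal R) free_algebra"
  using ring.genideal_ideal[OF ring_free_algebra] by auto

lemma nc_ideal_incl: "f \<in> R \<Longrightarrow> f \<in> nc_ideal R"
  using ring.genideal_self[OF ring_free_algebra, of R] by auto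

lemma nc_ideal_minimal: "ideal J free_algebra \<Longrightarrow> R \<subseteq> J \<Longrightarrow> nc_ideal R \<subseteq> J"
  using ring.genideal_minimal[OF ring_free_algebra] by auto

lemma nc_ideal_0 [simp]: "0 \<in> nc_ideal R"
  using additive_subgroup.zero_closed[OF ideal.axioms(1)[OF ideal_nc_ideal, of R]] by simp

lemma nc_ideal_add: "f \<in> nc_ideal R \<Longrightarrow> g \<in> nc_ideal R \<Longrightarrow> f + g \<in> nc_ideal R"
  using additive_subgroup.a_closed[OF ideal.axioms(1)[OF ideal_nc_ideal, of R]] by simp

lemma nc_ideal_mult_left: "f \<in> nc_ideal R \<Longrightarrow> g * f \<in> nc_ideal R"
  using ideal.I_l_closed[OF ideal_nc_ideal, of f R g] by simp

lemma nc_ideal_mult_right: "f \<in> nc_ideal R \<Longrightarrow> f * g \<in> nc_ideal R"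
  using ideal.I_r_closed[OF ideal_nc_ideal, of f R g] by simp

lemma nc_ideal_subset: "(\<And>f. f \<in> R \<Longrightarrow> f \<in> nc_ideal S) \<Longrightarrow> nc_ideal R \<subseteq> nc_ideal S"
  by (intro nc_ideal_minimal ideal_nc_ideal) auto

section \<open>Cosets and the operations of a presented algebra\<close>

lemma mem_presentation_map: "g \<in> presentation_map R f \<longleftrightarrow> (\<exists>i\<in>nc_ideal R. g = i + f)"
  by (auto simp: presentation_map_def a_r_coset_def r_coset_def)

lemma presentation_map_eq_iff:
  "presentation_map R f = presentation_map R g \<longleftrightarrow> f - g \<in> nc_ideal R"
proof -
  have "f - g = f \<ominus>\<^bsub>free_algebra\<^esub> g"
  proof -
    interpret ring "free_algebra :: ('a, 'a ncpoly) graded_algebra"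
      by (rule ring_free_algebra)
    have "\<ominus>\<^bsub>free_algebra\<^esub> g = - g" by (rule minus_equality) auto
    then show ?thesis by (simp add: a_minus_def)
  qed
  then show ?thesis
    unfolding presentation_map_def
    by (simp add: ring.quotient_eq_iff_same_a_r_cos[OF ring_free_algebra ideal_nc_ideal])
qed

lemma carrier_presented: "carrier (presented_algebra R) = range (presentation_map R)"
  by (auto simp: presented_algebra_def quotient_algebra_def FactRing_def A_RCOSETS_def'
      presentation_map_def)

lemma grade_presented:
  "grade (presented_algebra R) n = presentation_map R ` grade free_algebra n"
  by (simp add: presented_algebra_def quotient_algebra_def presentation_map_def)

lemma one_presented: "one (presented_algebra R) = presentation_map R 1"
  by (simp add: presented_algebra_def quotient_algebra_def FactRing_def presentation_map_def)

lemma zero_presented: "zero (presented_algebra R) = presentation_map R 0"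
  by (simp add: presented_algebra_def quotient_algebra_def FactRing_def presentation_map_def
      ring.a_rcos_zero[OF ring_free_algebra ideal_nc_ideal])

lemma mult_presented:
  "presentation_map R f \<otimes>\<^bsub>presented_algebra R\<^esub> presentation_map R g = presentation_map R (f * g)"
  using ideal.rcoset_mult_add[OF ideal_nc_ideal, of f g R]
  by (simp add: presented_algebra_def quotient_algebra_def FactRing_def presentation_map_def)

lemma add_presented:
  "presentation_map R f \<oplus>\<^bsub>presented_algebra R\<^esub> presentation_map R g = presentation_map R (f + g)"
  using ideal.a_rcos_sum[OF ideal_nc_ideal, of f g R]
  by (simp add: presented_algebra_def quotient_algebra_def FactRing_def presentation_map_def)

text \<open>The scalar multiple is defined as a union over all representatives. They all give the
  same coset because the ideal absorbs scalars, and the coset is nonempty.\<close>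

lemma smult_presented:
  "c \<odot>\<^bsub>presented_algebra R\<^esub> presentation_map R f = presentation_map R (const c * f)"
proof -
  have "presentation_map R (const c * g) = presentation_map R (const c * f)"
    if g: "g \<in> presentation_map R f" for g
  proof -
    obtain i where "i \<in> nc_ideal R" and "g = i + f"
      using g by (auto simp: mem_presentation_map)
    then have "const c * g - const c * f = const c * i" by (simp add: distrib_left)
    then show ?thesis
      using \<open>i \<in> nc_ideal R\<close> by (simp add: presentation_map_eq_iff nc_ideal_mult_left)
  qed
  moreover have "f \<in> presentation_map R f"
    unfolding mem_presentation_map by (rule bexI[of _ 0]) simp_all
  moreover have "c \<odot>\<^bsub>presented_algebra R\<^esub> presentation_map R f =
      (\<Union>g\<in>presentation_map R f. presentation_map R (const c * g))"
    by (simp add: presented_algebra_def quotient_algebra_def presentation_map_def)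
  ultimately show ?thesis by blast
qed

lemmas presented_simps = carrier_presented grade_presented one_presented zero_presented
  mult_presented add_presented smult_presented

text \<open>The ring operations are those of the factor ring, so the identity map transfers the ring
  axioms.\<close>

lemma ring_presented: "ring (presented_algebra R)"
proof -
  let ?Q = "free_algebra Quot nc_ideal R"
  have "ring ?Q" by (rule ideal.quotient_is_ring[OF ideal_nc_ideal])
  moreover have "id \<in> ring_iso ?Q (presented_algebra R)"
    by (auto simp: ring_iso_def ring_hom_def presented_algebra_def quotient_algebra_def)
  ultimately have "ring (presented_algebra R \<lparr>zero := id \<zero>\<^bsub>?Q\<^esub>\<rparr>)"
    by (rule ring.ring_iso_imp_img_ring)
  then show ?thesis by (simp add: presented_algebra_def quotient_algebra_def)
qed

section \<open>Degrees, linear substitutions and induced isomorphisms\<close>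

lemma grade_add:
  "f \<in> grade free_algebra n \<Longrightarrow> g \<in> grade free_algebra n \<Longrightarrow> f + g \<in> grade free_algebra n"
  by (auto simp: grade_free_algebra lookup_add) (metis add.right_neutral)

lemma grade_sum:
  "(\<And>x. x \<in> X \<Longrightarrow> F x \<in> grade free_algebra n) \<Longrightarrow> sum F X \<in> grade free_algebra n"
  by (induction X rule: infinite_finite_induct)
    (auto intro: grade_add simp: grade_free_algebra[of 0])

lemma grade_mult:
  assumes "f \<in> grade free_algebra m" and "g \<in> grade free_algebra n"
  shows "f * g \<in> grade free_algebra (m + n)"
  using assms keys_mult[of f g] by (fastforce simp: free_algebra_def plus_word_def)

lemma grade_const: "const c \<in> grade free_algebra 0"
  by (simp add: grade_free_algebra const_def lookup_single when_def zero_word_def)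

lemma grade_prod_list:
  "(\<And>g. \<phi> g \<in> grade free_algebra 1) \<Longrightarrow> prod_list (map \<phi> gs) \<in> grade free_algebra (length gs)"
proof (induction gs)
  case Nil
  then show ?case using grade_const[of 1] by simp
next
  case (Cons g gs)
  then show ?case using grade_mult[of "\<phi> g" 1 "prod_list (map \<phi> gs)"] by simp
qed

lemma grade_subst:
  assumes "\<And>g. \<phi> g \<in> grade free_algebra 1" and "f \<in> grade free_algebra n"
  shows "subst \<phi> f \<in> grade free_algebra n"
  unfolding subst_def
proof (rule grade_sum)
  fix w assume "w \<in> Poly_Mapping.keys f"
  then have "length (letters w) = n"
    using assms(2) by (auto simp: grade_free_algebra in_keys_iff)
  then show "const (lookup f w) * prod_list (map \<phi> (letters w)) \<in> grade free_algebra n"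
    using grade_mult[OF grade_const grade_prod_list[OF assms(1)]] by force
qed

text \<open>The preimage of an ideal under an endomorphism is an ideal, so it suffices to check the
  generators in \<open>R\<close>.\<close>

lemma subst_nc_ideal:
  assumes "\<And>f. f \<in> R \<Longrightarrow> subst \<phi> f \<in> nc_ideal S" and "f \<in> nc_ideal R"
  shows "subst \<phi> f \<in> nc_ideal S"
proof -
  have "ideal {f. subst \<phi> f \<in> nc_ideal S} free_algebra"
    by (rule ideal_free_algebraI)
      (auto simp: subst_add subst_mult nc_ideal_add nc_ideal_mult_left nc_ideal_mult_right)
  then have "nc_ideal R \<subseteq> {f. subst \<phi> f \<in> nc_ideal S}"
    by (rule nc_ideal_minimal) (use assms(1) in auto)
  then show ?thesis using assms(2) by auto
qed

text \<open>The two substitutions are mutually inverse automorphisms of the free algebra that carry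
  each ideal into the other. Hence they match the ideals exactly and descend to the quotients;
  linearity preserves degrees.\<close>

lemma presented_isoI:
  fixes \<phi> \<psi> :: "gen \<Rightarrow> 'k::field ncpoly"
  assumes inverse: "\<And>g. subst \<phi> (\<psi> g) = var g" "\<And>g. subst \<psi> (\<phi> g) = var g"
    and linear: "\<And>g. \<phi> g \<in> grade free_algebra 1" "\<And>g. \<psi> g \<in> grade free_algebra 1"
    and relations: "\<And>f. f \<in> R \<Longrightarrow> subst \<phi> f \<in> nc_ideal S"
      "\<And>f. f \<in> S \<Longrightarrow> subst \<psi> f \<in> nc_ideal R"
  shows "presented_algebra R \<cong>\<^sub>g\<^sub>r presented_algebra S"
proof -
  have \<phi>\<psi>: "subst \<phi> (subst \<psi> f) = f" and \<psi>\<phi>: "subst \<psi> (subst \<phi> f) = f" for f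
    by (simp_all add: subst_subst inverse subst_id)
  have image: "f \<in> nc_ideal S \<longleftrightarrow> (\<exists>g\<in>nc_ideal R. f = subst \<phi> g)" for f
    using subst_nc_ideal[OF relations(1)] subst_nc_ideal[OF relations(2)] \<phi>\<psi> by metis
  \<comment> \<open>Cosets are sets of polynomials, so the induced map is simply the image under the
    substitution.\<close>
  define h where "h = (\<lambda>C. subst \<phi> ` C)"
  have h: "h (presentation_map R f) = presentation_map S (subst \<phi> f)" for f
  proof -
    have "h (presentation_map R f) = (\<lambda>i. subst \<phi> (i + f)) ` nc_ideal R"
      by (auto simp: h_def image_iff mem_presentation_map)
    also have "\<dots> = presentation_map S (subst \<phi> f)"
      by (auto simp: subst_add mem_presentation_map image image_iff)
    finally show ?thesis .
  qed
  have "inj_on h (range (presentation_map R))"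
    unfolding h_def by (rule inj_onI) (metis \<psi>\<phi> injI inj_image_eq_iff)
  moreover have "h ` range (presentation_map R) = range (presentation_map S)"
  proof -
    have "presentation_map S f \<in> h ` range (presentation_map R)" for f
      by (rule image_eqI[of _ _ "presentation_map R (subst \<psi> f)"]) (simp_all add: h \<phi>\<psi>)
    then show ?thesis by (auto simp: h)
  qed
  moreover have "h ` presentation_map R ` grade free_algebra n =
      presentation_map S ` grade free_algebra n" for n
  proof -
    have "h ` presentation_map R ` grade free_algebra n =
        presentation_map S ` subst \<phi> ` grade free_algebra n"
      by (simp add: image_image h)
    moreover have "subst \<phi> ` grade free_algebra n = grade free_algebra n"
    proof
      show "grade free_algebra n \<subseteq> subst \<phi> ` grade free_algebra n"
      proof
        fix f :: "'k ncpoly" assume "f \<in> grade free_algebra n"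
        then have "subst \<psi> f \<in> grade free_algebra n" by (rule grade_subst[OF linear(2)])
        then show "f \<in> subst \<phi> ` grade free_algebra n" by (simp add: \<phi>\<psi> image_eqI[of f _ "subst \<psi> f"])
      qed
    qed (use grade_subst[OF linear(1)] in auto)
    ultimately show ?thesis by simp
  qed
  ultimately have "h \<in> graded_iso (presented_algebra R) (presented_algebra S)"
    by (auto simp: graded_iso_def ring_iso_def ring_hom_def bij_betw_def presented_simps h
        subst_mult subst_add)
  then show ?thesis by (auto simp: graded_isomorphic_def)
qed


section \<open>Linear and quadratic forms\<close>

definition lin :: "(gen \<Rightarrow> 'k::field) \<Rightarrow> 'k ncpoly" where
  "lin \<alpha> = (\<Sum>g\<in>UNIV. Poly_Mapping.single (Word [g]) (\<alpha> g))"

definition quad :: "(gen \<Rightarrow> gen \<Rightarrow> 'k::field) \<Rightarrow> 'k ncpoly" where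
  "quad C = (\<Sum>g\<in>UNIV. \<Sum>h\<in>UNIV. Poly_Mapping.single (Word [g, h]) (C g h))"

lemma lookup_lin:
  "lookup (lin \<alpha>) (Word []) = 0" "lookup (lin \<alpha>) (Word [g]) = \<alpha> g"
  "lookup (lin \<alpha>) (Word (a # b # w)) = 0"
  by (cases g; simp add: lin_def sum_gen lookup_add lookup_single when_def)+

lemma lookup_quad:
  "lookup (quad C) (Word []) = 0" "lookup (quad C) (Word [a]) = 0"
  "lookup (quad C) (Word [a, b]) = C a b" "lookup (quad C) (Word (a # b # c # w)) = 0"
  by (cases a; cases b; simp add: quad_def sum_gen lookup_add lookup_single when_def)+

text \<open>The coefficient matrix of a product of linear forms is an outer product, hence of rank
  at most one.\<close>

lemma lin_mult: "lin \<alpha> * lin \<beta> = quad (\<lambda>g h. \<alpha> g * \<beta> h)"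
  by (simp add: lin_def quad_def sum_product mult_single plus_word_def)

lemma grade_lin: "f \<in> grade free_algebra 1 \<longleftrightarrow> (\<exists>\<alpha>. f = lin \<alpha>)"
proof
  assume f: "f \<in> grade free_algebra 1"
  have "lookup f w = lookup (lin (\<lambda>g. lookup f (Word [g]))) w" for w
  proof (cases w)
    case (Word gs)
    with f show ?thesis
      \<comment> \<open>The rule splits words into those of length 0, length 1 and length at least
        2.\<close>
      by (cases gs rule: remdups_adj.cases) (auto simp: lookup_lin grade_free_algebra)
  qed
  then show "\<exists>\<alpha>. f = lin \<alpha>" by (blast intro: poly_mapping_eqI)
next
  assume "\<exists>\<alpha>. f = lin \<alpha>"
  then show "f \<in> grade free_algebra 1"
    by (auto simp: lin_def grade_free_algebra lookup_sum lookup_single when_def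
        elim!: sum.not_neutral_contains_not_neutral split: if_splits)
qed

lemma const_mult_lin: "const c * lin \<alpha> = lin (\<lambda>g. c * \<alpha> g)"
  by (simp add: lin_def sum_distrib_left const_mult_single)

lemma const_mult_quad: "const c * quad C = quad (\<lambda>g h. c * C g h)"
  by (simp add: quad_def sum_distrib_left const_mult_single)

lemma lin_add: "lin \<alpha> + lin \<beta> = lin (\<lambda>g. \<alpha> g + \<beta> g)"
  by (simp add: lin_def single_add sum.distrib)

lemma quad_add: "quad C + quad D = quad (\<lambda>g h. C g h + D g h)"
  by (simp add: quad_def single_add sum.distrib)

lemma var_lin: "var g = lin (\<lambda>h. if h = g then 1 else 0)"
  by (cases g) (simp_all add: lin_def var_def sum_gen)

lemma lin_var: "lin \<alpha> =
    const (\<alpha> Gen_x) * var Gen_x + const (\<alpha> Gen_y) * var Gen_y + const (\<alpha> Gen_z) * var Gen_z"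
  by (simp add: lin_def sum_gen var_def const_mult_single)

lemma subst_lin: "subst (\<lambda>g. lin (M g)) (lin \<alpha>) = lin (\<lambda>k. \<Sum>g\<in>UNIV. \<alpha> g * M g k)"
  unfolding lin_var[of \<alpha>]
  by (simp add: subst_add subst_mult const_mult_lin lin_add sum_gen)

text \<open>A linear change of generators acts on the coefficient matrix by congruence: C becomes
  the transpose of M, times C, times M.\<close>

lemma subst_quad:
  "subst (\<lambda>g. lin (M g)) (quad C) =
    quad (\<lambda>k l. \<Sum>g\<in>UNIV. \<Sum>h\<in>UNIV. C g h * (M g k * M h l))"
proof -
  have "subst (\<lambda>g. lin (M g)) (Poly_Mapping.single (Word [g, h]) c) =
      quad (\<lambda>k l. c * (M g k * M h l))" for g h c
    by (simp add: subst_single lin_mult const_mult_quad)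
  then show ?thesis
    unfolding quad_def[of C] by (simp add: sum_gen subst_add quad_add)
qed

section \<open>The relations of the Sklyanin algebras\<close>

text \<open>The coefficient matrix of the linear combination of the three defining relations with
  coefficients \<open>d Gen_x\<close>, \<open>d Gen_y\<close>, \<open>d Gen_z\<close>.\<close>

fun rel :: "'k::field \<Rightarrow> 'k \<Rightarrow> 'k \<Rightarrow> (gen \<Rightarrow> 'k) \<Rightarrow> gen \<Rightarrow> gen \<Rightarrow> 'k" where
  "rel p q r d Gen_x Gen_x = r * d Gen_x"
| "rel p q r d Gen_x Gen_y = p * d Gen_z"
| "rel p q r d Gen_x Gen_z = q * d Gen_y"
| "rel p q r d Gen_y Gen_x = q * d Gen_z"
| "rel p q r d Gen_y Gen_y = r * d Gen_y"
| "rel p q r d Gen_y Gen_z = p * d Gen_x"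
| "rel p q r d Gen_z Gen_x = p * d Gen_y"
| "rel p q r d Gen_z Gen_y = q * d Gen_x"
| "rel p q r d Gen_z Gen_z = r * d Gen_z"

lemma rel_linear:
  "rel p q r (\<lambda>k. a * d k) g h = a * rel p q r d g h"
  "rel p q r (\<lambda>k. d k + e k) g h = rel p q r d g h + rel p q r e g h"
  "rel (a * p) (a * q) (a * r) d g h = rel p q r (\<lambda>k. a * d k) g h"
  "rel p q r (\<lambda>k. 0) g h = 0"
  by (cases g; cases h; simp add: algebra_simps)+

lemma quad_gen:
  "quad C =
    const (C Gen_x Gen_x) * var Gen_x * var Gen_x + const (C Gen_x Gen_y) * var Gen_x * var Gen_y +
    const (C Gen_x Gen_z) * var Gen_x * var Gen_z + const (C Gen_y Gen_x) * var Gen_y * var Gen_x +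
    const (C Gen_y Gen_y) * var Gen_y * var Gen_y + const (C Gen_y Gen_z) * var Gen_y * var Gen_z +
    const (C Gen_z Gen_x) * var Gen_z * var Gen_x + const (C Gen_z Gen_y) * var Gen_z * var Gen_y +
    const (C Gen_z Gen_z) * var Gen_z * var Gen_z"
  by (simp add: quad_def sum_gen var_def const_mult_single mult_single plus_word_def add.assoc)

definition gen_unit :: "gen \<Rightarrow> gen \<Rightarrow> 'k::field" where
  "gen_unit g h = (if h = g then 1 else 0)"

text \<open>The relation indexed by \<open>g\<close> is the one whose square term is r times the
  square of that generator.\<close>

lemma sklyanin_relations_eq:
  "sklyanin_relations p q r = (\<lambda>g. quad (rel p q r (gen_unit g))) ` UNIV"
  by (simp add: UNIV_gen sklyanin_relations_def Let_def quad_gen gen_unit_def add_ac insert_commute)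

lemma quad_rel_in_nc_ideal: "quad (rel p q r d) \<in> nc_ideal (sklyanin_relations p q r)"
proof -
  have "rel p q r d = (\<lambda>g h. d Gen_x * rel p q r (gen_unit Gen_x) g h +
      d Gen_y * rel p q r (gen_unit Gen_y) g h + d Gen_z * rel p q r (gen_unit Gen_z) g h)"
  proof (intro ext)
    fix g h
    show "rel p q r d g h = d Gen_x * rel p q r (gen_unit Gen_x) g h +
      d Gen_y * rel p q r (gen_unit Gen_y) g h + d Gen_z * rel p q r (gen_unit Gen_z) g h"
      by (cases g; cases h; simp add: gen_unit_def)
  qed
  then have "quad (rel p q r d) = const (d Gen_x) * quad (rel p q r (gen_unit Gen_x)) +
      const (d Gen_y) * quad (rel p q r (gen_unit Gen_y)) +
      const (d Gen_z) * quad (rel p q r (gen_unit Gen_z))"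
    by (simp add: const_mult_quad quad_add)
  moreover have "quad (rel p q r (gen_unit g)) \<in> nc_ideal (sklyanin_relations p q r)" for g
    by (rule nc_ideal_incl) (auto simp: sklyanin_relations_eq)
  ultimately show ?thesis by (simp add: nc_ideal_add nc_ideal_mult_left)
qed

text \<open>The polynomials described by the conclusion form an ideal: as they have no terms of
  degree 0 or 1, multiplication by \<open>g\<close> on either side only scales their quadratic part
  by the constant coefficient of \<open>g\<close>. This ideal contains the relations.\<close>

lemma nc_ideal_sklyanin_low_degree:
  assumes "f \<in> nc_ideal (sklyanin_relations p q r)"
  shows "lookup f (Word []) = 0 \<and> (\<forall>a. lookup f (Word [a]) = 0) \<and>
    (\<exists>d. \<forall>a b. lookup f (Word [a, b]) = rel p q r d a b)"
proof -
  define J where "J = {f. lookup f (Word []) = 0 \<and> (\<forall>a. lookup f (Word [a]) = 0) \<and>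
    (\<exists>d. \<forall>a b. lookup f (Word [a, b]) = rel p q r d a b)}"
  have "ideal J free_algebra"
  proof (rule ideal_free_algebraI)
    show "0 \<in> J"
      by (auto simp: J_def rel_linear intro!: exI[of _ "\<lambda>_. 0"])
  next
    fix f g assume "f \<in> J" and "g \<in> J"
    then obtain d e where "\<forall>a b. lookup f (Word [a, b]) = rel p q r d a b"
      and "\<forall>a b. lookup g (Word [a, b]) = rel p q r e a b"
      by (auto simp: J_def)
    then have "\<forall>a b. lookup (f + g) (Word [a, b]) = rel p q r (\<lambda>k. d k + e k) a b"
      by (simp add: lookup_add rel_linear)
    with \<open>f \<in> J\<close> \<open>g \<in> J\<close> show "f + g \<in> J" by (auto simp: J_def lookup_add)
  next
    fix f g assume f: "f \<in> J"
    then obtain d where d: "\<forall>a b. lookup f (Word [a, b]) = rel p q r d a b"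
      by (auto simp: J_def)
    then have "\<forall>a b. lookup (g * f) (Word [a, b]) =
        rel p q r (\<lambda>k. lookup g (Word []) * d k) a b"
      using f by (simp add: J_def lookup_mult_word2 rel_linear)
    then show "g * f \<in> J"
      using f by (auto simp: J_def lookup_mult_word0 lookup_mult_word1)
    from d have "\<forall>a b. lookup (f * g) (Word [a, b]) =
        rel p q r (\<lambda>k. lookup g (Word []) * d k) a b"
      using f by (simp add: J_def lookup_mult_word2 rel_linear)
    then show "f * g \<in> J"
      using f by (auto simp: J_def lookup_mult_word0 lookup_mult_word1)
  qed
  moreover have "sklyanin_relations p q r \<subseteq> J"
    by (auto simp: J_def sklyanin_relations_eq lookup_quad)
  ultimately show ?thesis
    using nc_ideal_minimal assms unfolding J_def by blast
qed

lemma quad_in_nc_ideal_iff: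
  "quad C \<in> nc_ideal (sklyanin_relations p q r) \<longleftrightarrow> (\<exists>d. C = rel p q r d)"
proof
  assume "quad C \<in> nc_ideal (sklyanin_relations p q r)"
  from nc_ideal_sklyanin_low_degree[OF this] show "\<exists>d. C = rel p q r d"
    by (auto simp: lookup_quad fun_eq_iff)
qed (auto simp: quad_rel_in_nc_ideal)

lemma lin_in_nc_ideal_iff:
  "lin \<alpha> \<in> nc_ideal (sklyanin_relations p q r) \<longleftrightarrow> \<alpha> = (\<lambda>_. 0)"
proof
  assume "lin \<alpha> \<in> nc_ideal (sklyanin_relations p q r)"
  from nc_ideal_sklyanin_low_degree[OF this] show "\<alpha> = (\<lambda>_. 0)"
    by (auto simp: lookup_lin fun_eq_iff)
qed (simp add: lin_def)

lemma nc_ideal_sklyanin_000: "nc_ideal (sklyanin_relations 0 0 (0::'k::field)) = {0}"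
proof -
  have "sklyanin_relations 0 0 (0::'k) = {0}" by (simp add: sklyanin_relations_def)
  then show ?thesis
    using ring.genideal_zero[OF ring_free_algebra] by simp
qed

text \<open>Only the point (p:q:r) matters: proportional parameters generate the same ideal, hence
  give literally the same quotient.\<close>

lemma sklyanin_scale:
  assumes "a \<noteq> 0"
  shows "sklyanin (a * p) (a * q) (a * r) = sklyanin p q r"
proof -
  \<comment> \<open>This inclusion holds for every factor; the reverse one is its instance with
    \<open>inverse a\<close>.\<close>
  have le: "nc_ideal (sklyanin_relations (b * p) (b * q) (b * r)) \<subseteq> nc_ideal (sklyanin_relations p q r)"
    for b p q r :: 'a
    by (rule nc_ideal_subset)
      (auto simp: sklyanin_relations_eq[of "b * p"] quad_in_nc_ideal_iff rel_linear(3) fun_eq_iff)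
  have "nc_ideal (sklyanin_relations (a * p) (a * q) (a * r)) = nc_ideal (sklyanin_relations p q r)"
    using le[of a p q r] le[of "inverse a" "a * p" "a * q" "a * r"] assms
    by (simp flip: mult.assoc)
  then show ?thesis
    by (simp add: sklyanin_def presented_algebra_def)
qed

text \<open>The substitution by M takes the relation space of \<open>sklyanin p q r\<close> into
  that of \<open>sklyanin p' q' r'\<close>, with \<open>T\<close> recording its effect on
  coefficient vectors. Surjectivity of \<open>T\<close> makes it onto, so the inverse substitution
  by N respects the relations too.\<close>

lemma sklyanin_isoI:
  fixes M N :: "gen \<Rightarrow> gen \<Rightarrow> 'k::field"
  assumes inverse: "\<And>g k. (\<Sum>h\<in>UNIV. M g h * N h k) = (if k = g then 1 else 0)"
      "\<And>g k. (\<Sum>h\<in>UNIV. N g h * M h k) = (if k = g then 1 else 0)"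
    and transform: "\<And>d k l. (\<Sum>g\<in>UNIV. \<Sum>h\<in>UNIV. rel p q r d g h * (M g k * M h l)) =
      rel p' q' r' (T d) k l"
    and "surj T"
  shows "sklyanin p' q' r' \<cong>\<^sub>g\<^sub>r sklyanin p q r"
  unfolding sklyanin_def
proof (rule presented_isoI[of "\<lambda>g. lin (N g)" "\<lambda>g. lin (M g)"])
  show MN: "subst (\<lambda>g. lin (N g)) (lin (M g)) = var g" "subst (\<lambda>g. lin (M g)) (lin (N g)) = var g"
    for g
    by (simp_all add: subst_lin inverse var_lin)
  show "lin (M g) \<in> grade free_algebra 1" "lin (N g) \<in> grade free_algebra 1" for g
    unfolding grade_lin by blast+
  have M: "subst (\<lambda>g. lin (M g)) (quad (rel p q r d)) = quad (rel p' q' r' (T d))" for d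
    by (simp add: subst_quad transform)
  then show "subst (\<lambda>g. lin (M g)) f \<in> nc_ideal (sklyanin_relations p' q' r')"
    if "f \<in> sklyanin_relations p q r" for f
    using that by (auto simp: sklyanin_relations_eq[of p] quad_rel_in_nc_ideal)
  have "subst (\<lambda>g. lin (N g)) (quad (rel p' q' r' d)) \<in> nc_ideal (sklyanin_relations p q r)" for d
  proof -
    obtain e where "d = T e" using \<open>surj T\<close> by blast
    then have "subst (\<lambda>g. lin (N g)) (quad (rel p' q' r' d)) = quad (rel p q r e)"
      by (simp add: MN subst_subst subst_id flip: M)
    then show ?thesis by (simp add: quad_rel_in_nc_ideal)
  qed
  then show "subst (\<lambda>g. lin (N g)) f \<in> nc_ideal (sklyanin_relations p q r)"
    if "f \<in> sklyanin_relations p' q' r'" for f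
    using that by (auto simp: sklyanin_relations_eq[of p'])
qed


section \<open>The isomorphisms\<close>

text \<open>Exchanging x and y turns pyz+qzy+rxx into qzx+pxz+ryy, and likewise for the other
  relations.\<close>

lemma sklyanin_swap: "sklyanin q p r \<cong>\<^sub>g\<^sub>r sklyanin p q r"
proof -
  define s where "s g = (case g of Gen_x \<Rightarrow> Gen_y | Gen_y \<Rightarrow> Gen_x | Gen_z \<Rightarrow> Gen_z)" for g
  have [simp]: "s Gen_x = Gen_y" "s Gen_y = Gen_x" "s Gen_z = Gen_z" "s (s g) = g" for g
    by (cases g; simp add: s_def)+
  show ?thesis
  proof (rule sklyanin_isoI[of "\<lambda>g. gen_unit (s g)" "\<lambda>g. gen_unit (s g)" _ _ _ _ _ _ "\<lambda>d g. d (s g)"])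
    show "(\<Sum>g\<in>UNIV. \<Sum>h\<in>UNIV. rel p q r d g h * (gen_unit (s g) k * gen_unit (s h) l)) =
        rel q p r (\<lambda>g. d (s g)) k l" for d k l
      by (cases k; cases l; simp add: sum_gen gen_unit_def)
    show "surj (\<lambda>d g. d (s g))"
      by (rule surjI[of _ "\<lambda>d g. d (s g)"]) simp
  qed (case_tac g; case_tac k; simp add: sum_gen gen_unit_def)+
qed

text \<open>The relation space of \<open>Q\<^bsup>1,q,r\<^esup>\<close> with \<open>q\<^sup>3 = r\<^sup>3 = 1\<close> contains the three rank one
  elements \<open>u b * u (b * q)\<close> where \<open>b\<^sup>3 = 1\<close> and \<open>u b = x + b\<^sup>2 q\<^sup>2 y + b r\<^sup>2 z\<close>.
  Taking the three forms \<open>u b\<close> as new generators turns the relations into monomials: squares if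
  \<open>q = 1\<close>, and products of cyclically consecutive generators otherwise.\<close>

definition rank_one_form :: "'k::field \<Rightarrow> 'k \<Rightarrow> 'k \<Rightarrow> gen \<Rightarrow> 'k" where
  "rank_one_form q r b = case_gen 1 (b\<^sup>2 * q\<^sup>2) (b * r\<^sup>2)"

text \<open>Written for right-nested products: once factors are sorted, three adjacent copies of a
  cube root of unity cancel.\<close>

lemma cube_root_simps:
  fixes a :: "'k::field"
  assumes "a ^ 3 = 1"
  shows "a * (a * a) = 1" and "a * (a * (a * b)) = b"
  using assms by (simp_all add: power3_eq_cube flip: mult.assoc)

text \<open>The coefficient vector is read off the diagonal: r times its entries must be 1, b and
  b^2 q r. The off-diagonal entries then agree because q, r and b are cube roots of unity.\<close>

lemma rank_one_form_mult:
  fixes q r b :: "'k::field"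
  assumes "q ^ 3 = 1" "r ^ 3 = 1" "b ^ 3 = 1"
  shows "rank_one_form q r b g * rank_one_form q r (b * q) h =
    rel 1 q r (case_gen (r\<^sup>2) (b * r\<^sup>2) (b\<^sup>2 * q)) g h"
  unfolding rank_one_form_def
  by (cases g; cases h)
    (simp_all add: power2_eq_square mult_ac assms[THEN cube_root_simps(1)]
      assms[THEN cube_root_simps(2)])

text \<open>Labelling the cube roots of unity by generators lets the three forms u b be the rows of
  a square matrix.\<close>

definition root_gen :: "'k::field \<Rightarrow> gen \<Rightarrow> 'k" where
  "root_gen \<omega> = case_gen 1 \<omega> (\<omega>\<^sup>2)"

lemma root_of_unity_facts:
  fixes \<omega> :: "'k::field"
  assumes "CHAR('k) \<noteq> 3" and "\<omega> ^ 3 = 1" and "\<omega> \<noteq> 1"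
  shows "1 + \<omega> + \<omega>\<^sup>2 = 0" and "(3 :: 'k) \<noteq> 0"
proof -
  have "(\<omega> - 1) * (1 + \<omega> + \<omega>\<^sup>2) = 0"
    using assms(2) by (simp add: algebra_simps power2_eq_square power3_eq_cube)
  then show "1 + \<omega> + \<omega>\<^sup>2 = 0" using assms(3) by simp
  show "(3 :: 'k) \<noteq> 0"
  proof
    assume "(3 :: 'k) = 0"
    then have "of_nat 3 = (0 :: 'k)" by simp
    \<comment> \<open>The characteristic would be 1 or 3; the latter is excluded by assumption and
      the former by 1 \<noteq> 0.\<close>
    then have "CHAR('k) dvd 3" by (simp only: of_nat_eq_0_iff_char_dvd)
    moreover from this have "CHAR('k) \<le> 3" by (rule dvd_imp_le) simp
    moreover have "\<not> (0::nat) dvd 3" and "\<not> (2::nat) dvd 3" by simp_all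
    then have "CHAR('k) \<noteq> 0" "CHAR('k) \<noteq> 2" using calculation(1) by metis+
    ultimately have "CHAR('k) = 1" using assms(1) by linarith
    then show False using of_nat_CHAR[where 'a = 'k] by simp
  qed
qed

lemma graded_isomorphic_refl: "A \<cong>\<^sub>g\<^sub>r A"
proof -
  have "id \<in> graded_iso A A"
    by (simp add: graded_iso_def ring_iso_def ring_hom_def)
  then show ?thesis by (auto simp: graded_isomorphic_def)
qed

text \<open>The parameters are normalized to p = 1. The two conditions on \<open>\<omega>\<close>
  make it a primitive cube root of unity.\<close>

locale cube_roots =
  fixes \<omega> q r :: "'k::field"
  assumes omega: "1 + \<omega> + \<omega>\<^sup>2 = 0" and three: "(3 :: 'k) \<noteq> 0"
    and q_cube: "q ^ 3 = 1" and r_cube: "r ^ 3 = 1"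
begin

definition M :: "gen \<Rightarrow> gen \<Rightarrow> 'k" where
  "M g = rank_one_form q r (root_gen \<omega> g)"

text \<open>\<open>M\<close> is a discrete Fourier matrix with columns scaled by 1, q^2 and r^2. Its
  inverse has the inverse roots as entries, rows scaled by 1, q and r, and the factor 1/3.\<close>

definition N :: "gen \<Rightarrow> gen \<Rightarrow> 'k" where
  "N g k = case_gen 1 (q * root_gen \<omega> k) (r * (root_gen \<omega> k)\<^sup>2) g / 3"

text \<open>By \<open>rank_one_form_mult\<close>, \<open>D g\<close> consists of the coefficients of \<open>u b * u (b * q)\<close> with respect to
  the three relations of \<open>Q\<^bsup>1,q,r\<^esup>\<close>, where \<open>b = root_gen \<omega> g\<close>.\<close>

definition D :: "gen \<Rightarrow> gen \<Rightarrow> 'k" where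
  "D g = case_gen (r\<^sup>2) (root_gen \<omega> g * r\<^sup>2) ((root_gen \<omega> g)\<^sup>2 * q)"

lemma omega_simps: "\<omega> * \<omega> = - 1 - \<omega>" "\<omega> * (\<omega> * a) = - a - \<omega> * a"
proof -
  show *: "\<omega> * \<omega> = - 1 - \<omega>"
    using omega by (simp add: power2_eq_square eq_neg_iff_add_eq_0 algebra_simps)
  show "\<omega> * (\<omega> * a) = - a - \<omega> * a"
    by (simp add: * algebra_simps flip: mult.assoc)
qed

text \<open>Normal form: linear in \<open>\<omega>\<close> and of degree at most two in q and in
  r.\<close>

lemmas reduce = power2_eq_square algebra_simps omega_simps
  cube_root_simps[OF q_cube] cube_root_simps[OF r_cube]

lemma omega_cube: "\<omega> ^ 3 = 1"
  by (simp add: power3_eq_cube reduce)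

lemma three_N: "3 * N g k = case_gen 1 (q * root_gen \<omega> k) (r * (root_gen \<omega> k)\<^sup>2) g"
  using three by (simp add: N_def)

text \<open>Orthogonality of characters: if t is the quotient of the roots labelled by
  \<open>k\<close> and \<open>g\<close>, the sum is (1 + t + t^2)/3. Clearing the 3 first leaves
  polynomial identities.\<close>

lemma M_N: "(\<Sum>h\<in>UNIV. M g h * N h k) = (if k = g then 1 else 0)"
proof -
  have "(\<Sum>h\<in>UNIV. M g h * (3 * N h k)) = (if k = g then 3 else 0)"
    unfolding three_N M_def rank_one_form_def root_gen_def sum_gen
    by (cases g; cases k) (simp_all add: reduce)
  then have "3 * (\<Sum>h\<in>UNIV. M g h * N h k) = 3 * (if k = g then 1 else 0)"
    by (simp add: sum_distrib_left mult_ac)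
  then show ?thesis using three by (simp only: mult_cancel_left) simp
qed

lemma N_M: "(\<Sum>h\<in>UNIV. N g h * M h k) = (if k = g then 1 else 0)"
proof -
  have "(\<Sum>h\<in>UNIV. (3 * N g h) * M h k) = (if k = g then 3 else 0)"
    unfolding three_N M_def rank_one_form_def root_gen_def sum_gen
    by (cases g; cases k) (simp_all add: reduce)
  then have "3 * (\<Sum>h\<in>UNIV. N g h * M h k) = 3 * (if k = g then 1 else 0)"
    by (simp add: sum_distrib_left mult_ac)
  then show ?thesis using three by (simp only: mult_cancel_left) simp
qed

text \<open>The three rank one elements thus span the whole relation space of
  \<open>sklyanin 1 q r\<close>.\<close>

lemma D_surj: "\<exists>e. d = (\<lambda>k. \<Sum>g\<in>UNIV. e g * D g k)"
proof -
  \<comment> \<open>Fourier inversion again: for the root b, the row (r^2, b r^2, b^2 q) of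
    \<open>D\<close> is paired with the entrywise inverses r, b^2 r and b q^2.\<close>
  define e where "e g = r * d Gen_x + (root_gen \<omega> g)\<^sup>2 * r * d Gen_y + root_gen \<omega> g * q\<^sup>2 * d Gen_z" for g
  have "(\<Sum>g\<in>UNIV. e g * D g k) = 3 * d k" for k
    unfolding e_def D_def root_gen_def sum_gen
    by (cases k) (simp_all add: reduce)
  then have "(\<Sum>g\<in>UNIV. e g / 3 * D g k) = d k" for k
    using three by (simp flip: sum_divide_distrib)
  then show ?thesis by (intro exI[of _ "\<lambda>g. e g / 3"]) (simp add: fun_eq_iff)
qed

text \<open>A combination of the three rank one elements. The second factor is again a row of
  \<open>M\<close> when q is 1 (same row) or \<open>\<omega>\<close> (next row).\<close>

lemma M_mult:
  "(\<Sum>i\<in>UNIV. e i * (M i g * rank_one_form q r (root_gen \<omega> i * q) h)) =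
    rel 1 q r (\<lambda>k. \<Sum>i\<in>UNIV. e i * D i k) g h"
proof -
  have "root_gen \<omega> i ^ 3 = 1" for i
    by (cases i) (simp_all add: root_gen_def omega_cube power3_eq_cube reduce)
  from rank_one_form_mult[OF q_cube r_cube this]
  show ?thesis by (simp add: M_def sum_gen rel_linear D_def)
qed

lemma sklyanin_iso_squares:
  assumes "q = 1"
  shows "sklyanin 1 1 r \<cong>\<^sub>g\<^sub>r sklyanin 0 0 1"
proof (rule sklyanin_isoI[OF M_N N_M, where T = "\<lambda>e k. \<Sum>i\<in>UNIV. e i * D i k"])
  show "(\<Sum>g\<in>UNIV. \<Sum>h\<in>UNIV. rel 0 0 1 e g h * (M g k * M h l)) =
      rel 1 1 r (\<lambda>k. \<Sum>i\<in>UNIV. e i * D i k) k l" for e k l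
  proof -
    have "rank_one_form q r (root_gen \<omega> i * q) = M i" for i
    proof -
      have "root_gen \<omega> i * q = root_gen \<omega> i" using assms by simp
      then show ?thesis by (simp only: M_def)
    qed
    with M_mult[of e k l] show ?thesis using assms by (simp add: sum_gen)
  qed
  show "surj (\<lambda>e k. \<Sum>i\<in>UNIV. e i * D i k)"
    unfolding surj_def using D_surj by blast
qed

lemma sklyanin_iso_cyclic:
  assumes "q = \<omega>"
  shows "sklyanin 1 q r \<cong>\<^sub>g\<^sub>r sklyanin 1 0 0"
proof -
  \<comment> \<open>The product of row i and the next row comes from the monomial relation indexed
    by the remaining third generator, which is \<open>s i\<close>.\<close>
  define s where "s = case_gen Gen_z Gen_x Gen_y"
  define T where "T e k = (\<Sum>i\<in>UNIV. e (s i) * D i k)" for e k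
  show ?thesis
  proof (rule sklyanin_isoI[OF M_N N_M, where T = T])
    have "root_gen \<omega> Gen_x * q = root_gen \<omega> Gen_y" "root_gen \<omega> Gen_y * q = root_gen \<omega> Gen_z"
      "root_gen \<omega> Gen_z * q = root_gen \<omega> Gen_x"
      using assms omega_cube by (simp_all add: root_gen_def power2_eq_square power3_eq_cube)
    then show "(\<Sum>g\<in>UNIV. \<Sum>h\<in>UNIV. rel 1 0 0 e g h * (M g k * M h l)) =
        rel 1 q r (T e) k l" for e k l
      using M_mult[of "\<lambda>i. e (s i)" k l]
      by (simp add: sum_gen M_def s_def T_def[abs_def] add_ac)
    have "\<exists>e. d = T e" for d
    proof -
      obtain e where "d = (\<lambda>k. \<Sum>i\<in>UNIV. e i * D i k)" using D_surj by blast
      \<comment> \<open>The coefficients are permuted by the inverse of \<open>s\<close>.\<close>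
      then have "d = T (case_gen (e Gen_y) (e Gen_z) (e Gen_x))"
        by (simp add: T_def s_def sum_gen fun_eq_iff add_ac)
      then show ?thesis by blast
    qed
    then show "surj T" by (auto simp: surj_def)
  qed
qed

end

section \<open>Reduction of degenerate parameters to the monomial algebras\<close>

lemma sklyanin_iso_100:
  fixes p q r :: "'k::field"
  assumes "CHAR('k) \<noteq> 3"
    and "(r = 0 \<and> p * q = 0 \<and> (p, q) \<noteq> (0, 0)) \<or>
      (p ^ 3 = q ^ 3 \<and> q ^ 3 = r ^ 3 \<and> r ^ 3 \<noteq> 0 \<and> p \<noteq> q)"
  shows "sklyanin p q r \<cong>\<^sub>g\<^sub>r sklyanin 1 0 0"
  using assms(2)
proof
  assume *: "r = 0 \<and> p * q = 0 \<and> (p, q) \<noteq> (0, 0)"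
  show ?thesis
  proof (cases "q = 0")
    case True
    with * have "sklyanin p q r = sklyanin 1 0 0"
      using sklyanin_scale[of p 1 0 0] by auto
    then show ?thesis by (simp add: graded_isomorphic_refl)
  next
    case False
    with * have "sklyanin p q r = sklyanin 0 1 0"
      using sklyanin_scale[of q 0 1 0] by auto
    then show ?thesis using sklyanin_swap by simp
  qed
next
  assume *: "p ^ 3 = q ^ 3 \<and> q ^ 3 = r ^ 3 \<and> r ^ 3 \<noteq> 0 \<and> p \<noteq> q"
  then have "p \<noteq> 0" by auto
  with * have q: "(q / p) ^ 3 = 1" "q / p \<noteq> 1" and r: "(r / p) ^ 3 = 1"
    by (auto simp: power_divide)
  \<comment> \<open>After scaling to p = 1 the ratio q/p is itself a primitive cube root of unity
    and serves as \<open>\<omega>\<close>.\<close>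
  interpret cube_roots "q / p" "q / p" "r / p"
    using root_of_unity_facts[OF assms(1) q] q r by unfold_locales
  show ?thesis
    using sklyanin_iso_cyclic[OF refl] sklyanin_scale[OF \<open>p \<noteq> 0\<close>, of 1 "q / p" "r / p"] \<open>p \<noteq> 0\<close>
    by simp
qed

lemma sklyanin_iso_001:
  fixes p q r \<theta> :: "'k::field"
  assumes "CHAR('k) \<noteq> 3" and "\<theta> ^ 3 = 1" and "\<theta> \<noteq> 1"
    and "(p = 0 \<and> q = 0 \<and> r \<noteq> 0) \<or> (p = q \<and> q \<noteq> 0 \<and> p ^ 3 = r ^ 3)"
  shows "sklyanin p q r \<cong>\<^sub>g\<^sub>r sklyanin 0 0 1"
  using assms(4)
proof
  assume "p = 0 \<and> q = 0 \<and> r \<noteq> 0"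
  then have "sklyanin p q r = sklyanin 0 0 1"
    using sklyanin_scale[of r 0 0 1] by auto
  then show ?thesis by (simp add: graded_isomorphic_refl)
next
  assume *: "p = q \<and> q \<noteq> 0 \<and> p ^ 3 = r ^ 3"
  then have r: "(r / p) ^ 3 = 1" by (auto simp: power_divide)
  \<comment> \<open>Here q/p = 1 is not primitive, so the given \<open>\<theta>\<close> supplies the
    root.\<close>
  interpret cube_roots \<theta> 1 "r / p"
    using root_of_unity_facts[OF assms(1-3)] r by unfold_locales simp_all
  show ?thesis
    using sklyanin_iso_squares[OF refl] sklyanin_scale[of p 1 1 "r / p"] * by simp
qed


section \<open>Invariants\<close>

definition has_linear_zero_divisors :: "('k, 'a) graded_algebra \<Rightarrow> bool" where
  "has_linear_zero_divisors A \<longleftrightarrow>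
    (\<exists>u\<in>grade A 1. \<exists>v\<in>grade A 1. u \<noteq> \<zero>\<^bsub>A\<^esub> \<and> v \<noteq> \<zero>\<^bsub>A\<^esub> \<and> u \<otimes>\<^bsub>A\<^esub> v = \<zero>\<^bsub>A\<^esub>)"

definition has_linear_square_zero :: "('k, 'a) graded_algebra \<Rightarrow> bool" where
  "has_linear_square_zero A \<longleftrightarrow>
    (\<exists>u\<in>grade A 1. u \<noteq> \<zero>\<^bsub>A\<^esub> \<and> u \<otimes>\<^bsub>A\<^esub> u = \<zero>\<^bsub>A\<^esub>)"

lemma graded_iso_zero_product:
  assumes "h \<in> graded_iso A B" and "ring A" and "ring B"
    and "\<And>n. grade A n \<subseteq> carrier A" and "u \<in> grade A m" and "v \<in> grade A n"
  shows "h u \<otimes>\<^bsub>B\<^esub> h v = \<zero>\<^bsub>B\<^esub> \<longleftrightarrow> u \<otimes>\<^bsub>A\<^esub> v = \<zero>\<^bsub>A\<^esub>"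
    and "h u = \<zero>\<^bsub>B\<^esub> \<longleftrightarrow> u = \<zero>\<^bsub>A\<^esub>"
proof -
  interpret A: ring A by fact
  interpret B: ring B by fact
  have h: "h \<in> ring_hom A B" and inj: "inj_on h (carrier A)"
    using assms(1) by (auto simp: graded_iso_def ring_iso_def bij_betw_def)
  interpret h: ring_hom_ring A B h
    by (rule ring_hom_ringI2[OF assms(2,3) h])
  have zero: "h a = \<zero>\<^bsub>B\<^esub> \<longleftrightarrow> a = \<zero>\<^bsub>A\<^esub>" if "a \<in> carrier A" for a
    using inj_onD[OF inj, of a "\<zero>\<^bsub>A\<^esub>"] that h.hom_zero by auto
  have u: "u \<in> carrier A" and v: "v \<in> carrier A" using assms(4-6) by auto
  show "h u = \<zero>\<^bsub>B\<^esub> \<longleftrightarrow> u = \<zero>\<^bsub>A\<^esub>" using u by (rule zero)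
  show "h u \<otimes>\<^bsub>B\<^esub> h v = \<zero>\<^bsub>B\<^esub> \<longleftrightarrow> u \<otimes>\<^bsub>A\<^esub> v = \<zero>\<^bsub>A\<^esub>"
    using zero[of "u \<otimes>\<^bsub>A\<^esub> v"] u v by simp
qed

text \<open>A graded isomorphism maps the degree one parts onto each other and both preserves and
  reflects vanishing of elements and products.\<close>

lemma graded_isomorphic_invariants:
  assumes "A \<cong>\<^sub>g\<^sub>r B" and "ring A" and "ring B" and "\<And>n. grade A n \<subseteq> carrier A"
  shows "has_linear_zero_divisors A \<longleftrightarrow> has_linear_zero_divisors B"
    and "has_linear_square_zero A \<longleftrightarrow> has_linear_square_zero B"
proof -
  obtain h where h: "h \<in> graded_iso A B"
    using assms(1) by (auto simp: graded_isomorphic_def)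
  then have grade: "grade B n = h ` grade A n" for n by (auto simp: graded_iso_def)
  note eq = graded_iso_zero_product[OF h assms(2-4)]
  show "has_linear_zero_divisors A \<longleftrightarrow> has_linear_zero_divisors B"
    unfolding has_linear_zero_divisors_def grade by (simp add: eq cong: bex_cong)
  show "has_linear_square_zero A \<longleftrightarrow> has_linear_square_zero B"
    unfolding has_linear_square_zero_def grade by (simp add: eq cong: bex_cong)
qed

lemma sklyanin_invariants:
  assumes "sklyanin p q r \<cong>\<^sub>g\<^sub>r sklyanin p' q' r'"
  shows "has_linear_zero_divisors (sklyanin p q r) \<longleftrightarrow> has_linear_zero_divisors (sklyanin p' q' r')"
    and "has_linear_square_zero (sklyanin p q r) \<longleftrightarrow> has_linear_square_zero (sklyanin p' q' r')"
  using graded_isomorphic_invariants[OF assms] unfolding sklyanin_def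
  by (auto simp: ring_presented grade_presented carrier_presented)

section \<open>The invariants as conditions on rank one matrices\<close>

lemma grade_1_sklyanin:
  "grade (sklyanin p q r) 1 = range (\<lambda>\<alpha>. presentation_map (sklyanin_relations p q r) (lin \<alpha>))"
  unfolding sklyanin_def grade_presented set_eq_iff image_iff Bex_def grade_lin by blast

lemma lin_zero_sklyanin:
  "presentation_map (sklyanin_relations p q r) (lin \<alpha>) = \<zero>\<^bsub>sklyanin p q r\<^esub> \<longleftrightarrow> \<alpha> = (\<lambda>_. 0)"
  by (simp add: sklyanin_def zero_presented presentation_map_eq_iff lin_in_nc_ideal_iff)

lemma lin_mult_zero_sklyanin:
  "presentation_map (sklyanin_relations p q r) (lin \<alpha>) \<otimes>\<^bsub>sklyanin p q r\<^esub>
    presentation_map (sklyanin_relations p q r) (lin \<beta>) = \<zero>\<^bsub>sklyanin p q r\<^esub> \<longleftrightarrow>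
    (\<exists>d. \<forall>g h. \<alpha> g * \<beta> h = rel p q r d g h)"
  by (simp add: sklyanin_def zero_presented mult_presented presentation_map_eq_iff lin_mult
      quad_in_nc_ideal_iff fun_eq_iff)

lemma zero_divisors_sklyanin:
  "has_linear_zero_divisors (sklyanin p q r) \<longleftrightarrow>
    (\<exists>\<alpha> \<beta> d. \<alpha> \<noteq> (\<lambda>_. 0) \<and> \<beta> \<noteq> (\<lambda>_. 0) \<and> (\<forall>g h. \<alpha> g * \<beta> h = rel p q r d g h))"
  unfolding has_linear_zero_divisors_def grade_1_sklyanin
  by (simp add: lin_zero_sklyanin lin_mult_zero_sklyanin)

lemma square_zero_sklyanin:
  "has_linear_square_zero (sklyanin p q r) \<longleftrightarrow>
    (\<exists>\<alpha> d. \<alpha> \<noteq> (\<lambda>_. 0) \<and> (\<forall>g h. \<alpha> g * \<alpha> h = rel p q r d g h))"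
  unfolding has_linear_square_zero_def grade_1_sklyanin
  by (simp add: lin_zero_sklyanin lin_mult_zero_sklyanin)

lemma zero_divisors_100: "has_linear_zero_divisors (sklyanin 1 0 (0::'k::field))"
  unfolding zero_divisors_sklyanin
proof (intro exI conjI)
  show "\<forall>g h. gen_unit Gen_x g * gen_unit Gen_y h = rel 1 0 (0::'k) (gen_unit Gen_z) g h"
    by (simp add: all_gen gen_unit_def)
qed (auto simp: fun_eq_iff gen_unit_def)

lemma square_zero_001: "has_linear_square_zero (sklyanin 0 0 (1::'k::field))"
  unfolding square_zero_sklyanin
proof (intro exI conjI)
  show "\<forall>g h. gen_unit Gen_x g * gen_unit Gen_x h = rel 0 0 (1::'k) (gen_unit Gen_x) g h"
    by (simp add: all_gen gen_unit_def)
qed (auto simp: fun_eq_iff gen_unit_def)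

lemma zero_divisors_001: "has_linear_zero_divisors (sklyanin 0 0 (1::'k::field))"
  using square_zero_001
  unfolding has_linear_square_zero_def has_linear_zero_divisors_def by blast

text \<open>All matrices in the relation space have zero diagonal, which forces the square of every
  coefficient of the form to vanish.\<close>

lemma no_square_zero_100: "\<not> has_linear_square_zero (sklyanin 1 0 (0::'k::field))"
  by (auto simp: square_zero_sklyanin all_gen fun_eq_iff)

lemma no_zero_divisors_free:
  "\<not> has_linear_zero_divisors (free_algebra :: ('k::field, 'k ncpoly) graded_algebra)"
  unfolding has_linear_zero_divisors_def Bex_def grade_lin
proof (safe, simp)
  fix \<alpha> \<beta> :: "gen \<Rightarrow> 'k"
  assume *: "lin \<alpha> \<noteq> 0" "lin \<beta> \<noteq> 0" "lin \<alpha> * lin \<beta> = 0"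
  have "\<alpha> g * \<beta> h = 0" for g h
    using lookup_quad(3)[of "\<lambda>g h. \<alpha> g * \<beta> h" g h] *(3) by (simp add: lin_mult)
  then have "\<alpha> = (\<lambda>_. 0) \<or> \<beta> = (\<lambda>_. 0)" by (auto simp: fun_eq_iff)
  then show False using *(1,2) by (auto simp: lin_def)
qed

lemma no_zero_divisors_nondegenerate:
  fixes p q r :: "'k::field"
  assumes "\<not> degenerate p q r"
  shows "\<not> has_linear_zero_divisors (sklyanin p q r)"
  unfolding zero_divisors_sklyanin
proof safe
  fix \<alpha> \<beta> d :: "gen \<Rightarrow> 'k"
  assume nz: "\<alpha> \<noteq> (\<lambda>_. 0)" "\<beta> \<noteq> (\<lambda>_. 0)" and eq: "\<forall>g h. \<alpha> g * \<beta> h = rel p q r d g h"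
  \<comment> \<open>a product of linear forms has a coefficient matrix of rank one\<close>
  have minor: "rel p q r d g h * rel p q r d g' h' = rel p q r d g h' * rel p q r d g' h" for g h g' h'
    by (simp add: mult_ac flip: eq[rule_format])
  \<comment> \<open>For a cyclic triple, \<open>d k\<close> sits in the entries (i,j), (j,i) and
    (k,k). Each minor equates a product of two of these with a product of an entry in
    \<open>d i\<close> and an entry in \<open>d j\<close>.\<close>
  have minors:
    "d i * d j * r\<^sup>2 = (d k)\<^sup>2 * (p * q)"
    "d i * d j * q\<^sup>2 = (d k)\<^sup>2 * (p * r)"
    "d i * d j * p\<^sup>2 = (d k)\<^sup>2 * (q * r)"
    if "(i, j, k) \<in> {(Gen_x, Gen_y, Gen_z), (Gen_y, Gen_z, Gen_x), (Gen_z, Gen_x, Gen_y)}" for i j k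
    using that minor[of i i j j] minor[of i k k j] minor[of k i j k]
    by (auto simp: power2_eq_square mult_ac)
  have product_zero: "d i * d j = 0"
    if "(i, j, k) \<in> {(Gen_x, Gen_y, Gen_z), (Gen_y, Gen_z, Gen_x), (Gen_z, Gen_x, Gen_y)}" for i j k
  proof (rule ccontr)
    assume "d i * d j \<noteq> 0"
    \<comment> \<open>Multiplying the three minors by r, q and p gives them a common right-hand
      side, so cancelling \<open>d i * d j\<close> equates the cubes.\<close>
    moreover have "d i * d j * r ^ 3 = (d k)\<^sup>2 * (p * q * r)"
      using minors(1)[OF that] by (simp add: power2_eq_square power3_eq_cube mult_ac)
    moreover have "d i * d j * q ^ 3 = (d k)\<^sup>2 * (p * q * r)"
      using minors(2)[OF that] by (simp add: power2_eq_square power3_eq_cube mult_ac)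
    moreover have "d i * d j * p ^ 3 = (d k)\<^sup>2 * (p * q * r)"
      using minors(3)[OF that] by (simp add: power2_eq_square power3_eq_cube mult_ac)
    ultimately have "p ^ 3 = q ^ 3 \<and> q ^ 3 = r ^ 3" by (metis mult_cancel_left)
    with assms show False by (simp add: degenerate_def)
  qed
  \<comment> \<open>Now the square of \<open>d k\<close> is annihilated by pq, pr and qr, one of
    which is nonzero.\<close>
  have "d k = 0"
    if "(i, j, k) \<in> {(Gen_x, Gen_y, Gen_z), (Gen_y, Gen_z, Gen_x), (Gen_z, Gen_x, Gen_y)}" for i j k
    using minors[OF that] product_zero[OF that] assms by (auto simp: degenerate_def)
  then have "d = (\<lambda>_. 0)" by (auto simp: fun_eq_iff all_gen)
  then have "\<alpha> g * \<beta> h = 0" for g h using eq rel_linear(4)[of p q r g h] by simp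
  then show False using nz by (auto simp: fun_eq_iff)
qed

section \<open>The free algebra against algebras with relations\<close>

lemma quad_eq_0D: "quad C = 0 \<Longrightarrow> C g h = 0"
  using lookup_quad(3)[of C g h] by simp

text \<open>The preimages of x, y, z are linearly independent linear forms in the free algebra and
  must satisfy the first relation there. Independence removes its terms one by one.\<close>

lemma sklyanin_000_iso_imp_zero:
  fixes p q r :: "'k::field"
  assumes iso: "sklyanin 0 0 0 \<cong>\<^sub>g\<^sub>r sklyanin p q r"
  shows "p = 0 \<and> q = 0 \<and> r = 0"
proof -
  let ?F = "presentation_map (sklyanin_relations 0 0 (0::'k))"
  let ?Q = "presentation_map (sklyanin_relations p q r)"
  obtain h where h: "h \<in> graded_iso (sklyanin 0 0 0) (sklyanin p q r)"
    using iso by (auto simp: graded_isomorphic_def)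
  \<comment> \<open>The isomorphism acts on cosets; this relation lets one calculate with
    representatives on both sides.\<close>
  define match where "match f g \<longleftrightarrow> h (?F f) = ?Q g" for f g
  have add: "match (f + f') (g + g')" if "match f g" "match f' g'" for f g f' g'
  proof -
    have "h (?F f \<oplus>\<^bsub>sklyanin 0 0 0\<^esub> ?F f') = h (?F f) \<oplus>\<^bsub>sklyanin p q r\<^esub> h (?F f')"
      using h by (auto simp: graded_iso_def ring_iso_def ring_hom_def sklyanin_def carrier_presented)
    then show ?thesis
      using that by (simp add: match_def sklyanin_def add_presented)
  qed
  have mult: "match (f * f') (g * g')" if "match f g" "match f' g'" for f g f' g'
  proof -
    have "h (?F f \<otimes>\<^bsub>sklyanin 0 0 0\<^esub> ?F f') = h (?F f) \<otimes>\<^bsub>sklyanin p q r\<^esub> h (?F f')"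
      using h by (auto simp: graded_iso_def ring_iso_def ring_hom_def sklyanin_def carrier_presented)
    then show ?thesis
      using that by (simp add: match_def sklyanin_def mult_presented)
  qed
  have smult: "match (const c * f) (const c * g)" if "match f g" for c f g
  proof -
    have "h (c \<odot>\<^bsub>sklyanin 0 0 0\<^esub> ?F f) = c \<odot>\<^bsub>sklyanin p q r\<^esub> h (?F f)"
      using h by (auto simp: graded_iso_def sklyanin_def carrier_presented)
    then show ?thesis
      using that by (simp add: match_def sklyanin_def smult_presented)
  qed
  have "\<exists>\<alpha>. match (lin \<alpha>) (var g)" for g
  proof -
    have "?Q (var g) \<in> grade (sklyanin p q r) 1"
      unfolding grade_1_sklyanin var_lin by (rule rangeI)
    also have "\<dots> = h ` grade (sklyanin 0 0 0) 1" using h by (simp add: graded_iso_def)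
    finally obtain \<alpha> where "?Q (var g) = h (?F (lin \<alpha>))"
      unfolding grade_1_sklyanin by blast
    then have "match (lin \<alpha>) (var g)" by (simp add: match_def)
    then show ?thesis by blast
  qed
  then obtain U where U: "match (lin (U g)) (var g)" for g by metis
  have "match 0 0"
    using smult[OF U, of 0] by simp
  have zero: "f = 0 \<longleftrightarrow> g \<in> nc_ideal (sklyanin_relations p q r)" if "match f g" for f g
  proof -
    have "inj_on h (range ?F)"
      using h by (simp add: graded_iso_def ring_iso_def bij_betw_def sklyanin_def carrier_presented)
    then have "h (?F f) = h (?F 0) \<longleftrightarrow> ?F f = ?F 0"
      by (rule inj_on_eq_iff) simp_all
    also have "\<dots> \<longleftrightarrow> f = 0"
      by (simp add: presentation_map_eq_iff nc_ideal_sklyanin_000)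
    finally have "f = 0 \<longleftrightarrow> h (?F f) = h (?F 0)" ..
    then show ?thesis
      using that \<open>match 0 0\<close> by (simp add: match_def presentation_map_eq_iff)
  qed
  \<comment> \<open>A vanishing combination of the preimages matches \<open>lin \<alpha>\<close>,
    which is zero in the quotient only for \<alpha> = 0, as there are no linear relations.\<close>
  have independent: "\<alpha> = (\<lambda>_. 0)" if "\<forall>k. (\<Sum>g\<in>UNIV. \<alpha> g * U g k) = 0" for \<alpha>
  proof -
    have "match (const (\<alpha> Gen_x) * lin (U Gen_x) + const (\<alpha> Gen_y) * lin (U Gen_y) +
        const (\<alpha> Gen_z) * lin (U Gen_z)) (lin \<alpha>)"
      unfolding lin_var[of \<alpha>] by (intro add smult U)
    moreover have "const (\<alpha> Gen_x) * lin (U Gen_x) + const (\<alpha> Gen_y) * lin (U Gen_y) +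
        const (\<alpha> Gen_z) * lin (U Gen_z) = 0"
      using that by (simp add: const_mult_lin lin_add sum_gen) (simp add: lin_def)
    ultimately show ?thesis using zero lin_in_nc_ideal_iff by blast
  qed
  have "match (const p * lin (U Gen_y) * lin (U Gen_z) + const q * lin (U Gen_z) * lin (U Gen_y) +
      const r * lin (U Gen_x) * lin (U Gen_x))
    (const p * var Gen_y * var Gen_z + const q * var Gen_z * var Gen_y + const r * var Gen_x * var Gen_x)"
    by (intro add mult[OF smult[OF U] U])
  moreover have "const p * var Gen_y * var Gen_z + const q * var Gen_z * var Gen_y +
      const r * var Gen_x * var Gen_x \<in> nc_ideal (sklyanin_relations p q r)"
    by (rule nc_ideal_incl) (simp add: sklyanin_relations_def Let_def)
  ultimately have "const p * lin (U Gen_y) * lin (U Gen_z) + const q * lin (U Gen_z) * lin (U Gen_y) +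
      const r * lin (U Gen_x) * lin (U Gen_x) = 0"
    using zero by blast
  moreover define C where "C k l = p * (U Gen_y k * U Gen_z l) + q * (U Gen_z k * U Gen_y l) +
      r * (U Gen_x k * U Gen_x l)" for k l
  ultimately have "quad C = 0"
    unfolding C_def[abs_def] by (simp add: mult.assoc lin_mult const_mult_quad quad_add)
  then have C: "C k l = 0" for k l by (rule quad_eq_0D)
  \<comment> \<open>For fixed \<open>l\<close>, the equations \<open>C k l = 0\<close> form a linear
    dependence among the three vectors \<open>U g\<close>, with these coefficients.\<close>
  have "case_gen (r * U Gen_x l) (p * U Gen_z l) (q * U Gen_y l) = (\<lambda>_. 0)" for l
    using C[of _ l] by (intro independent) (simp add: C_def sum_gen algebra_simps)
  then have zeros: "r * U Gen_x l = 0" "p * U Gen_z l = 0" "q * U Gen_y l = 0" for l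
    by (simp_all add: fun_eq_iff all_gen)
  have "\<exists>l. U g l \<noteq> 0" for g
  proof (rule ccontr)
    assume "\<nexists>l. U g l \<noteq> 0"
    then have "\<forall>k. (\<Sum>i\<in>UNIV. gen_unit g i * U i k) = 0"
      by (cases g) (simp_all add: sum_gen gen_unit_def)
    then have "gen_unit g = (\<lambda>_. 0 :: 'k)" by (rule independent)
    then have "gen_unit g g = (0 :: 'k)" by (rule fun_cong)
    then show False by (simp add: gen_unit_def)
  qed
  with zeros show ?thesis by (metis mult_eq_0_iff)
qed

text \<open>The canonical map kills the first relation, so injectivity makes that polynomial zero,
  and its coefficients are p, q and r. Conversely, zero parameters generate the zero ideal.\<close>

lemma sklyanin_is_free_iff: "sklyanin_is_free p q r \<longleftrightarrow> p = 0 \<and> q = 0 \<and> r = 0"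
proof
  let ?\<pi> = "presentation_map (sklyanin_relations p q r)"
  let ?f = "const p * var Gen_y * var Gen_z + const q * var Gen_z * var Gen_y + const r * var Gen_x * var Gen_x"
  assume "sklyanin_is_free p q r"
  then have "inj ?\<pi>"
    by (auto simp: sklyanin_is_free_def graded_iso_def ring_iso_def bij_betw_def)
  moreover have "?f \<in> nc_ideal (sklyanin_relations p q r)"
    by (rule nc_ideal_incl) (simp add: sklyanin_relations_def Let_def)
  then have "?\<pi> ?f = ?\<pi> 0" by (simp add: presentation_map_eq_iff)
  ultimately have "?f = 0" by (rule injD)
  moreover have "?f = quad (rel p q r (gen_unit Gen_x))"
    by (simp add: quad_gen gen_unit_def)
  ultimately have "quad (rel p q r (gen_unit Gen_x)) = 0" by simp
  note quad_eq_0D[OF this]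
  from this[of Gen_x Gen_x] this[of Gen_y Gen_z] this[of Gen_z Gen_y]
  show "p = 0 \<and> q = 0 \<and> r = 0" by (simp add: gen_unit_def)
next
  assume zero: "p = 0 \<and> q = 0 \<and> r = 0"
  let ?\<pi> = "presentation_map (sklyanin_relations p q r)"
  have "?\<pi> f = ?\<pi> g \<longleftrightarrow> f = g" for f g
    using zero by (simp add: presentation_map_eq_iff nc_ideal_sklyanin_000)
  then show "sklyanin_is_free p q r"
    by (simp add: sklyanin_is_free_def graded_iso_def ring_iso_def ring_hom_def bij_betw_def
        sklyanin_def presented_simps inj_on_def)
qed

section \<open>Classification of the degenerate algebras\<close>

theorem lemma5p2:
  fixes \<theta> :: "'k::field"
  assumes "CHAR('k) \<noteq> 3"
    and "\<theta> ^ 3 = 1" and "\<theta> \<noteq> 1"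
  shows
    "(\<forall>p q r :: 'k. degenerate p q r \<longrightarrow>
        (sklyanin_is_free p q r \<longleftrightarrow> p = 0 \<and> q = 0 \<and> r = 0) \<and>
        (sklyanin p q r \<cong>\<^sub>g\<^sub>r sklyanin 1 0 0 \<longleftrightarrow>
           (r = 0 \<and> p * q = 0 \<and> (p, q) \<noteq> (0, 0)) \<or>
           (p ^ 3 = q ^ 3 \<and> q ^ 3 = r ^ 3 \<and> r ^ 3 \<noteq> 0 \<and> p \<noteq> q)) \<and>
        (sklyanin p q r \<cong>\<^sub>g\<^sub>r sklyanin 0 0 1 \<longleftrightarrow>
           (p = 0 \<and> q = 0 \<and> r \<noteq> 0) \<or>
           (p = q \<and> q \<noteq> 0 \<and> p ^ 3 = r ^ 3))) \<and>
     sklyanin 1 0 0 = presented_algebra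
       {var Gen_x * var Gen_y, var Gen_z * var Gen_x, var Gen_y * var Gen_z :: 'k ncpoly} \<and>
     sklyanin 0 0 1 = presented_algebra
       {var Gen_x * var Gen_x, var Gen_y * var Gen_y, var Gen_z * var Gen_z :: 'k ncpoly} \<and>
     \<not> (free_algebra :: ('k, 'k ncpoly) graded_algebra) \<cong>\<^sub>g\<^sub>r (sklyanin 1 0 0 :: ('k, 'k ncpoly set) graded_algebra) \<and>
     \<not> (free_algebra :: ('k, 'k ncpoly) graded_algebra) \<cong>\<^sub>g\<^sub>r (sklyanin 0 0 1 :: ('k, 'k ncpoly set) graded_algebra) \<and>
     \<not> (sklyanin 1 0 0 :: ('k, 'k ncpoly set) graded_algebra) \<cong>\<^sub>g\<^sub>r sklyanin 0 0 1 \<and>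
     (\<forall>p q r p' q' r' :: 'k. degenerate p q r \<and> \<not> degenerate p' q' r' \<longrightarrow>
        \<not> sklyanin p q r \<cong>\<^sub>g\<^sub>r sklyanin p' q' r')"
proof -
  define P where "P p q r \<longleftrightarrow> (r = 0 \<and> p * q = 0 \<and> (p, q) \<noteq> (0, 0)) \<or>
      (p ^ 3 = q ^ 3 \<and> q ^ 3 = r ^ 3 \<and> r ^ 3 \<noteq> 0 \<and> p \<noteq> q)" for p q r :: 'k
  define S where "S p q r \<longleftrightarrow> (p = 0 \<and> q = 0 \<and> r \<noteq> 0) \<or>
      (p = q \<and> q \<noteq> 0 \<and> p ^ 3 = r ^ 3)" for p q r :: 'k
  have trichotomy: "p = 0 \<and> q = 0 \<and> r = 0 \<or> P p q r \<or> S p q r" if "degenerate p q r" for p q r :: 'k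
    using that by (auto simp: degenerate_def P_def S_def)
  have P: "sklyanin p q r \<cong>\<^sub>g\<^sub>r sklyanin 1 0 0" if "P p q r" for p q r
    using sklyanin_iso_100[OF assms(1)] that by (simp only: P_def)
  have S: "sklyanin p q r \<cong>\<^sub>g\<^sub>r sklyanin 0 0 1" if "S p q r" for p q r
    using sklyanin_iso_001[OF assms] that by (simp only: S_def)
  have free: "\<not> sklyanin 0 0 0 \<cong>\<^sub>g\<^sub>r sklyanin 1 0 (0::'k)"
      "\<not> sklyanin 0 0 0 \<cong>\<^sub>g\<^sub>r sklyanin 0 0 (1::'k)"
    using sklyanin_000_iso_imp_zero by force+
  \<comment> \<open>Through the given algebra, \<open>sklyanin 1 0 0\<close> and
    \<open>sklyanin 0 0 1\<close> would agree on having a linear form with square zero.\<close>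
  have not_both: False
    if "sklyanin p q r \<cong>\<^sub>g\<^sub>r sklyanin 1 0 0" "sklyanin p q r \<cong>\<^sub>g\<^sub>r sklyanin 0 0 1" for p q r :: 'k
    using that[THEN sklyanin_invariants(2)] square_zero_001 no_square_zero_100 by blast
  \<comment> \<open>Each degenerate algebra falls under one of three cases, and the cases exclude
    each other up to isomorphism; this gives the converse directions.\<close>
  have iff: "(sklyanin p q r \<cong>\<^sub>g\<^sub>r sklyanin 1 0 0 \<longleftrightarrow> P p q r) \<and>
      (sklyanin p q r \<cong>\<^sub>g\<^sub>r sklyanin 0 0 1 \<longleftrightarrow> S p q r)" if "degenerate p q r" for p q r :: 'k
    using trichotomy[OF that] P S free not_both by blast
  have non_free: "\<not> (free_algebra :: ('k, 'k ncpoly) graded_algebra) \<cong>\<^sub>g\<^sub>r sklyanin a b c"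
    if "has_linear_zero_divisors (sklyanin a b c)" for a b c :: 'k
  proof
    assume "(free_algebra :: ('k, 'k ncpoly) graded_algebra) \<cong>\<^sub>g\<^sub>r sklyanin a b c"
    from graded_isomorphic_invariants(1)[OF this ring_free_algebra] show False
      using that by (simp add: sklyanin_def ring_presented no_zero_divisors_free)
  qed
  \<comment> \<open>Linear zero divisors separate the two monomial cases from the non-degenerate
    algebras; the case of zero parameters rests on linear independence instead.\<close>
  have nondegenerate: "\<not> sklyanin p q r \<cong>\<^sub>g\<^sub>r sklyanin p' q' r'"
    if "degenerate p q r" "\<not> degenerate p' q' r'" for p q r p' q' r' :: 'k
    using trichotomy[OF that(1)]
  proof (elim disjE)
    assume "p = 0 \<and> q = 0 \<and> r = 0"
    moreover have "\<not> (p' = 0 \<and> q' = 0 \<and> r' = 0)" using that(2) by (auto simp: degenerate_def)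
    ultimately show ?thesis using sklyanin_000_iso_imp_zero by blast
  next
    assume "P p q r"
    then have "has_linear_zero_divisors (sklyanin p q r)"
      using sklyanin_invariants(1)[OF P] zero_divisors_100 by blast
    then show ?thesis
      using sklyanin_invariants(1) no_zero_divisors_nondegenerate[OF that(2)] by blast
  next
    assume "S p q r"
    then have "has_linear_zero_divisors (sklyanin p q r)"
      using sklyanin_invariants(1)[OF S] zero_divisors_001 by blast
    then show ?thesis
      using sklyanin_invariants(1) no_zero_divisors_nondegenerate[OF that(2)] by blast
  qed
  have monomial: "sklyanin 1 0 0 = presented_algebra
       {var Gen_x * var Gen_y, var Gen_z * var Gen_x, var Gen_y * var Gen_z :: 'k ncpoly}"
    "sklyanin 0 0 1 = presented_algebra
       {var Gen_x * var Gen_x, var Gen_y * var Gen_y, var Gen_z * var Gen_z :: 'k ncpoly}"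
  proof -
    have "sklyanin_relations 1 0 (0::'k) =
        {var Gen_x * var Gen_y, var Gen_z * var Gen_x, var Gen_y * var Gen_z}"
      by (auto simp: sklyanin_relations_def Let_def)
    then show "sklyanin 1 0 0 = presented_algebra
       {var Gen_x * var Gen_y, var Gen_z * var Gen_x, var Gen_y * var Gen_z :: 'k ncpoly}"
      unfolding sklyanin_def by (rule arg_cong)
    have "sklyanin_relations 0 0 (1::'k) =
        {var Gen_x * var Gen_x, var Gen_y * var Gen_y, var Gen_z * var Gen_z}"
      by (auto simp: sklyanin_relations_def Let_def)
    then show "sklyanin 0 0 1 = presented_algebra
       {var Gen_x * var Gen_x, var Gen_y * var Gen_y, var Gen_z * var Gen_z :: 'k ncpoly}"
      unfolding sklyanin_def by (rule arg_cong)
  qed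
  have "\<not> sklyanin 1 0 (0::'k) \<cong>\<^sub>g\<^sub>r sklyanin 0 0 1"
    using not_both graded_isomorphic_refl by blast
  then show ?thesis
    unfolding sklyanin_is_free_iff
    by (intro conjI allI impI monomial refl iff[unfolded P_def S_def, THEN conjunct1]
        iff[unfolded P_def S_def, THEN conjunct2] non_free zero_divisors_100 zero_divisors_001)
      (use nondegenerate in auto)
qed

end
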